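(* Let $V$ be a linear subspace of $\mathbb R^n$ of dimension $\alpha n$ for some $\alpha\in(0,1)$. For any $\varepsilon\in(0,1/4)$, the number of vectors in $\{\pm\frac1{\sqrt n}\}^n$ whose Euclidean distance to $V$ is at most $\varepsilon$ is at most \[2^{\left(H_2(4\varepsilon^2)+\alpha\log\frac3\varepsilon\right)n}.\]
   Context: $H_2(p)=-p\log_2p-(1-p)\log_2(1-p)$ is the binary entropy function; $\log$ is base 2. *)

theory Defs imports "HOL-Analysis.Analysis" begin

definition H2 :: "real \<Rightarrow> real" where
  "H2 p = - p * log 2 p - (1 - p) * log 2 (1 - p)"

definition sign_cube :: "(real ^ 'n) set" where
  "sign_cube = {x. \<forall>i. x $ i \<in> {1 / sqrt (real CARD('n)), - (1 / sqrt (real CARD('n)))}}"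

end

theory Submission imports Defs begin

text \<open>
  The orthogonal projection to \<open>V\<close> of a point \<open>x\<close> of the cube lies in the unit ball of \<open>V\<close>, which by
  a volume argument has an \<open>\<epsilon>\<close>-net of size at most \<open>(3/\<epsilon>)\<^bsup>dim V\<^esup>\<close>; so if \<open>x\<close> is within \<open>\<epsilon>\<close> of \<open>V\<close>, it
  is within \<open>2\<epsilon>\<close> of a net point. Two cube points within \<open>2\<epsilon>\<close> of the same net point are within \<open>4\<epsilon>\<close>
  of each other, i.e. differ in at most \<open>4\<epsilon>\<^sup>2n\<close> coordinates, so each net point accounts for at most the
  volume \<open>2\<^bsup>H\<^sub>2(4\<epsilon>\<^sup>2)n\<^esup>\<close> of a Hamming ball.
\<close>

subsection \<open>Packing in a subspace\<close>

definition coord_proj :: "'a::euclidean_space set \<Rightarrow> 'a \<Rightarrow> 'a" where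
  "coord_proj D x = (\<Sum>i\<in>D. (x \<bullet> i) *\<^sub>R i)"

text \<open>The unit cube factor gives a lower-dimensional ball positive Lebesgue measure in the ambient space.\<close>

definition cylinder :: "'a::euclidean_space set \<Rightarrow> real \<Rightarrow> 'a set" where
  "cylinder D r = {x. norm (coord_proj D x) \<le> r \<and> (\<forall>i\<in>Basis - D. 0 \<le> x \<bullet> i \<and> x \<bullet> i \<le> 1)}"

lemma linear_coord_proj: "linear (coord_proj D)"
  unfolding coord_proj_def
  by (auto intro!: linearI simp: inner_add_left scaleR_add_left sum.distrib scaleR_sum_right)

lemma coord_proj_inner:
  assumes "D \<subseteq> Basis" "i \<in> Basis"
  shows "coord_proj D x \<bullet> i = (if i \<in> D then x \<bullet> i else 0)"
proof -
  have "finite D"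
    using assms(1) finite_Basis finite_subset by blast
  have "coord_proj D x \<bullet> i = (\<Sum>j\<in>D. if j = i then x \<bullet> i else 0)"
    unfolding coord_proj_def inner_sum_left
    by (rule sum.cong) (use assms in \<open>auto simp: inner_Basis\<close>)
  with \<open>finite D\<close> show ?thesis
    by simp
qed

lemma norm_coord_proj_le:
  assumes "D \<subseteq> Basis"
  shows "norm (coord_proj D x) \<le> norm x"
  using assms by (intro norm_le_componentwise) (auto simp: coord_proj_inner)

lemma compact_cylinder:
  fixes D :: "'a::euclidean_space set"
  assumes "D \<subseteq> Basis"
  shows "compact (cylinder D r)"
proof -
  have "cylinder D r =
      {x. norm (coord_proj D x) \<le> r} \<inter> (\<Inter>i\<in>Basis - D. {x. 0 \<le> x \<bullet> i} \<inter> {x. x \<bullet> i \<le> 1})"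
    by (auto simp: cylinder_def)
  moreover have "closed {x::'a. norm (coord_proj D x) \<le> r}"
    unfolding coord_proj_def by (intro closed_Collect_le continuous_intros)
  moreover have "closed (\<Inter>i\<in>Basis - D. {x::'a. 0 \<le> x \<bullet> i} \<inter> {x. x \<bullet> i \<le> 1})"
    by (intro closed_INT ballI closed_Int closed_Collect_le continuous_intros)
  ultimately have "closed (cylinder D r)"
    by auto
  moreover have "bounded (cylinder D r)"
  proof (rule bounded_subset[OF bounded_cbox])
    \<comment> \<open>The box has to cover the coordinates in \<open>D\<close>, bounded by
      \<open>r\<close>, and the others, bounded by \<open>1\<close>; the absolute value avoids a
      sign condition on \<open>r\<close>.\<close>
    show "cylinder D r \<subseteq> cbox (\<Sum>i\<in>Basis. - (\<bar>r\<bar> + 1) *\<^sub>R i) (\<Sum>i\<in>Basis. (\<bar>r\<bar> + 1) *\<^sub>R i)"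
    proof
      fix x assume x: "x \<in> cylinder D r"
      have "\<bar>x \<bullet> i\<bar> \<le> \<bar>r\<bar> + 1" if "i \<in> Basis" for i
      proof (cases "i \<in> D")
        case True
        then have "\<bar>x \<bullet> i\<bar> = \<bar>coord_proj D x \<bullet> i\<bar>"
          using assms that by (simp add: coord_proj_inner)
        also have "\<dots> \<le> norm (coord_proj D x)"
          using that by (rule Basis_le_norm)
        also have "\<dots> \<le> r"
          using x by (simp add: cylinder_def)
        finally show ?thesis by simp
      next
        case False
        then have "0 \<le> x \<bullet> i" "x \<bullet> i \<le> 1"
          using x that by (auto simp: cylinder_def)
        then show ?thesis by simp
      qed
      then show "x \<in> cbox (\<Sum>i\<in>Basis. - (\<bar>r\<bar> + 1) *\<^sub>R i) (\<Sum>i\<in>Basis. (\<bar>r\<bar> + 1) *\<^sub>R i)"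
        by (fastforce simp: mem_box abs_le_iff simp del: sum_negf scaleR_minus_left)
    qed
  qed
  ultimately show ?thesis
    by (simp add: compact_eq_bounded_closed)
qed

lemma measure_cylinder_pos:
  fixes D :: "'a::euclidean_space set"
  assumes "D \<subseteq> Basis"
  shows "0 < measure lebesgue (cylinder D 1)"
proof -
  \<comment> \<open>A centre of the cylinder: \<open>0\<close> along \<open>D\<close> and the
    midpoint of \<open>[0,1]\<close> in every other direction, so a ball of radius
    \<open>1/2\<close> meets both constraints.\<close>
  define c :: 'a where "c = (\<Sum>i\<in>Basis. (if i \<in> D then 0 else 1/2) *\<^sub>R i)"
  have c: "c \<bullet> i = (if i \<in> D then 0 else 1/2)" if "i \<in> Basis" for i
    using that by (simp add: c_def)
  have "ball c (1/2) \<subseteq> cylinder D 1"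
  proof
    fix x assume "x \<in> ball c (1/2)"
    then have n: "norm (x - c) < 1/2"
      by (simp add: dist_norm norm_minus_commute)
    have "coord_proj D c = 0"
      by (rule euclidean_eqI) (simp add: coord_proj_inner[OF assms] c)
    then have "norm (coord_proj D x) = norm (coord_proj D (x - c))"
      by (simp add: linear_diff[OF linear_coord_proj])
    also have "\<dots> \<le> norm (x - c)"
      by (rule norm_coord_proj_le[OF assms])
    finally have "norm (coord_proj D x) \<le> 1"
      using n by simp
    moreover have "0 \<le> x \<bullet> i \<and> x \<bullet> i \<le> 1" if "i \<in> Basis - D" for i
      using Basis_le_norm[of i "x - c"] n that by (auto simp: inner_diff_left c abs_le_iff)
    ultimately show "x \<in> cylinder D 1"
      by (auto simp: cylinder_def)
  qed
  then have "measure lebesgue (ball c (1/2)) \<le> measure lebesgue (cylinder D 1)"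
    by (intro measure_mono_fmeasurable lmeasurable_compact compact_cylinder assms) auto
  moreover have "0 < measure lebesgue (ball c (1/2))"
    using content_ball_pos[of "1/2" c] by simp
  ultimately show ?thesis by linarith
qed

text \<open>The map that scales the coordinates in \<open>D\<close> by \<open>r\<close> and fixes
  the others pulls the cylinder of radius \<open>r\<close> back to that of radius \<open>1\<close>,
  with Jacobian \<open>r ^ card D\<close>. The cube factor stays unscaled, so the exponent is
  \<open>card D\<close> and not the ambient dimension.\<close>

lemma measure_cylinder:
  fixes D :: "'a::euclidean_space set"
  assumes D: "D \<subseteq> Basis" and r: "0 < r"
  shows "measure lebesgue (cylinder D r) = r ^ card D * measure lebesgue (cylinder D 1)"
proof -
  define c :: "'a \<Rightarrow> real" where "c = (\<lambda>i. if i \<in> D then r else 1)"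
  \<comment> \<open>The summand \<open>0\<close> puts \<open>T\<close> in the shape of the affine
    map in \<open>lborel_affine_euclidean\<close>.\<close>
  define T :: "'a \<Rightarrow> 'a" where "T = (\<lambda>x. 0 + (\<Sum>j\<in>Basis. (c j * (x \<bullet> j)) *\<^sub>R j))"
  have T: "T x \<bullet> i = c i * (x \<bullet> i)" if "i \<in> Basis" for x i
    using that by (simp add: T_def)
  have "coord_proj D (T x) = r *\<^sub>R coord_proj D x" for x
    by (rule euclidean_eqI) (simp add: coord_proj_inner[OF D] T c_def)
  then have "norm (coord_proj D (T x)) \<le> r \<longleftrightarrow> norm (coord_proj D x) \<le> 1" for x
    using r by simp
  then have vimage: "T -` cylinder D r = cylinder D 1"
    by (auto simp: cylinder_def T c_def)
  have meas: "T \<in> borel_measurable borel"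
    unfolding T_def by measurable
  have borel: "cylinder D s \<in> sets borel" for s :: real
    using compact_cylinder[OF D] by (simp add: compact_imp_closed)
  have "(\<Prod>j\<in>Basis. \<bar>c j\<bar>) = (\<Prod>j\<in>D. r)"
    unfolding c_def using D r by (intro prod.mono_neutral_cong_right) auto
  then have prod: "(\<Prod>j\<in>Basis. \<bar>c j\<bar>) = r ^ card D"
    by simp
  have "lborel = density (distr lborel borel T) (\<lambda>_. ennreal (\<Prod>j\<in>Basis. \<bar>c j\<bar>))"
    unfolding T_def by (rule lborel_affine_euclidean) (use r in \<open>simp add: c_def\<close>)
  then have "emeasure lborel (cylinder D r) =
      emeasure (density (distr lborel borel T) (\<lambda>_. ennreal (r ^ card D))) (cylinder D r)"
    unfolding prod by simp
  also have "\<dots> = ennreal (r ^ card D) * emeasure lborel (cylinder D 1)"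
    using meas borel by (simp add: emeasure_density emeasure_distr vimage nn_integral_cmult_indicator)
  finally show ?thesis
    using r borel by (simp add: measure_def enn2real_mult)
qed

section \<open>Separated sets and nets\<close>

text \<open>Volume packing: translates of the cylinder of radius \<open>e/2\<close> to the points of
  \<open>F\<close> are disjoint and lie in the cylinder of radius \<open>1 + e/2\<close>. Dividing
  the measures leaves \<open>((1 + e/2) / (e/2)) ^ card D\<close>.\<close>

lemma card_separated_coord_subspace_le:
  fixes D :: "'a::euclidean_space set"
  assumes D: "D \<subseteq> Basis" and e: "0 < e" and fin: "finite F"
    and F: "\<And>x. x \<in> F \<Longrightarrow> coord_proj D x = x"
    and norm: "\<And>x. x \<in> F \<Longrightarrow> norm x \<le> 1"
    and sep: "\<And>x y. x \<in> F \<Longrightarrow> y \<in> F \<Longrightarrow> x \<noteq> y \<Longrightarrow> e < dist x y"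
  shows "real (card F) \<le> (1 + 2 / e) ^ card D"
proof -
  let ?\<mu> = "measure lebesgue"
  let ?C = "\<lambda>x. (+) x ` cylinder D (e/2)"
  have lm: "cylinder D r \<in> lmeasurable" for r
    by (intro lmeasurable_compact compact_cylinder D)
  have C: "?C x \<in> lmeasurable" for x
    by (rule measurable_translation[OF lm])
  have "disjoint_family_on ?C F"
  proof (unfold disjoint_family_on_def, intro ballI impI, rule ccontr)
    fix x y assume xy: "x \<in> F" "y \<in> F" "x \<noteq> y" and "?C x \<inter> ?C y \<noteq> {}"
    then obtain u v where uv: "u \<in> cylinder D (e/2)" "v \<in> cylinder D (e/2)" "x + u = y + v"
      by auto
    then have "coord_proj D (x + u) = coord_proj D (y + v)"
      by simp
    then have "x + coord_proj D u = y + coord_proj D v"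
      using xy F by (simp add: linear_add[OF linear_coord_proj])
    then have "x - y = coord_proj D v - coord_proj D u"
      by (simp add: algebra_simps)
    then have "dist x y \<le> norm (coord_proj D v) + norm (coord_proj D u)"
      by (simp add: dist_norm norm_triangle_ineq4)
    also have "\<dots> \<le> e"
      using uv by (simp add: cylinder_def)
    finally show False
      using sep[OF xy] by simp
  qed
  moreover have "emeasure lebesgue (?C x) \<noteq> \<infinity>" for x
    using C[of x] by (auto simp: fmeasurable_def)
  ultimately have "?\<mu> (\<Union>x\<in>F. ?C x) = (\<Sum>x\<in>F. ?\<mu> (?C x))"
    using C by (intro measure_finite_Union fin) auto
  then have "card F * ?\<mu> (cylinder D (e/2)) = ?\<mu> (\<Union>x\<in>F. ?C x)"
    by (simp add: measure_translation)
  also have "\<dots> \<le> ?\<mu> (cylinder D (1 + e/2))"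
  proof (rule measure_mono_fmeasurable)
    show "(\<Union>x\<in>F. ?C x) \<subseteq> cylinder D (1 + e/2)"
    proof safe
      fix x u assume x: "x \<in> F" and u: "u \<in> cylinder D (e/2)"
      have "coord_proj D (x + u) = x + coord_proj D u"
        using F[OF x] by (simp add: linear_add[OF linear_coord_proj])
      then have "norm (coord_proj D (x + u)) \<le> 1 + e/2"
        using norm[OF x] u norm_triangle_ineq[of x "coord_proj D u"] by (simp add: cylinder_def)
      \<comment> \<open>Points of \<open>F\<close> vanish off \<open>D\<close>, so translating by
        them leaves the cube factor in place.\<close>
      moreover have "(x + u) \<bullet> i = u \<bullet> i" if "i \<in> Basis - D" for i
        using coord_proj_inner[OF D, of i x] F[OF x] that by (simp add: inner_add_left)
      ultimately show "x + u \<in> cylinder D (1 + e/2)"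
        using u by (simp add: cylinder_def)
    qed
    show "(\<Union>x\<in>F. ?C x) \<in> sets lebesgue"
      using C fin by (intro sets.finite_UN) auto
  qed (rule lm)
  finally have "card F * (e/2) ^ card D * ?\<mu> (cylinder D 1) \<le> (1 + e/2) ^ card D * ?\<mu> (cylinder D 1)"
    using measure_cylinder[OF D, of "e/2"] measure_cylinder[OF D, of "1 + e/2"] e
    by (simp add: mult.assoc)
  then have "card F * (e/2) ^ card D \<le> (1 + e/2) ^ card D"
    using measure_cylinder_pos[OF D] by simp
  then have "card F \<le> (1 + e/2) ^ card D / (e/2) ^ card D"
    using e by (simp add: pos_le_divide_eq)
  also have "\<dots> = ((1 + e/2) / (e/2)) ^ card D"
    by (rule power_divide[symmetric])
  also have "(1 + e/2) / (e/2) = 1 + 2 / e"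
    using e by (simp add: field_simps)
  finally show ?thesis .
qed

text \<open>A linear map takes \<open>V\<close> onto a coordinate subspace of the same dimension and
  preserves norms and distances on \<open>V\<close>, which reduces the bound to the coordinate
  case.\<close>

lemma card_separated_subspace_le:
  fixes V :: "'a::euclidean_space set"
  assumes V: "subspace V" and e: "0 < e" and fin: "finite F" and F: "F \<subseteq> V"
    and norm: "\<And>x. x \<in> F \<Longrightarrow> norm x \<le> 1"
    and sep: "\<And>x y. x \<in> F \<Longrightarrow> y \<in> F \<Longrightarrow> x \<noteq> y \<Longrightarrow> e < dist x y"
  shows "real (card F) \<le> (1 + 2 / e) ^ dim V"
proof -
  have "dim V \<le> card (Basis :: 'a set)"
    using dim_subset_UNIV[of V] by simp
  then obtain D :: "'a set" where D: "D \<subseteq> Basis" "card D = dim V"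
    by (meson obtain_subset_with_card_n)
  let ?T = "{x::'a. \<forall>i\<in>Basis. i \<notin> D \<longrightarrow> x \<bullet> i = 0}"
  obtain f where f: "linear f" "f ` V = ?T" "\<And>x. x \<in> V \<Longrightarrow> norm (f x) = norm x"
    by (rule isometry_subspaces[OF V subspace_substandard[of "\<lambda>i. i \<notin> D"]])
      (use dim_substandard[OF D(1)] D(2) in auto)
  have dist: "dist (f x) (f y) = dist x y" if "x \<in> V" "y \<in> V" for x y
    using f(3)[OF subspace_diff[OF V that]] by (simp add: dist_norm linear_diff[OF f(1)])
  then have "inj_on f V"
    by (metis dist_eq_0_iff inj_onI)
  then have card: "card (f ` F) = card F"
    using F by (meson card_image inj_on_subset)
  have "real (card (f ` F)) \<le> (1 + 2 / e) ^ card D"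
  proof (rule card_separated_coord_subspace_le[OF D(1) e])
    fix x assume "x \<in> f ` F"
    then have "x \<in> ?T"
      using f(2) F by blast
    show "coord_proj D x = x"
      by (rule euclidean_eqI) (use \<open>x \<in> ?T\<close> in \<open>simp add: coord_proj_inner[OF D(1)]\<close>)
    show "norm x \<le> 1"
      using \<open>x \<in> f ` F\<close> norm f(3) F by auto
  next
    fix x y assume "x \<in> f ` F" "y \<in> f ` F" "x \<noteq> y"
    then obtain u v where "u \<in> F" "v \<in> F" "u \<noteq> v" "x = f u" "y = f v"
      by auto
    then show "e < dist x y"
      using sep dist F by (metis subsetD)
  qed (use fin in simp)
  with card D(2) show ?thesis
    by simp
qed

text \<open>A separated subset of the unit ball of \<open>V\<close> with the greatest number of
  points is a net: a point farther than \<open>e\<close> from all of it could be added. The packing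
  bound both ensures that a greatest one exists and limits its size.\<close>

lemma ball_net_subspace:
  fixes V :: "'a::euclidean_space set"
  assumes V: "subspace V" and e: "0 < e"
  obtains F where "finite F" "real (card F) \<le> (1 + 2 / e) ^ dim V"
    "\<And>x. x \<in> V \<Longrightarrow> norm x \<le> 1 \<Longrightarrow> \<exists>y\<in>F. dist x y \<le> e"
proof -
  define P where "P F \<longleftrightarrow> finite F \<and> F \<subseteq> V \<and> (\<forall>x\<in>F. norm x \<le> 1) \<and>
    (\<forall>x\<in>F. \<forall>y\<in>F. x \<noteq> y \<longrightarrow> e < dist x y)" for F
  have bound: "real (card F) \<le> (1 + 2 / e) ^ dim V" if "P F" for F
    using that unfolding P_def by (intro card_separated_subspace_le[OF V e]) auto
  \<comment> \<open>\<open>Suc\<close> makes the rounded-up packing bound strict, as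
    \<open>ex_has_greatest_nat\<close> expects.\<close>
  have "card F < Suc (nat \<lceil>(1 + 2 / e) ^ dim V\<rceil>)" if "P F" for F
    using bound[OF that] by linarith
  then have bounded: "\<forall>F. P F \<longrightarrow> card F < Suc (nat \<lceil>(1 + 2 / e) ^ dim V\<rceil>)"
    by blast
  have "P {}"
    by (simp add: P_def)
  from ex_has_greatest_nat[of P, OF this bounded]
  have "\<exists>F. P F \<and> (\<forall>G. P G \<longrightarrow> card G \<le> card F)" .
  then obtain F where F: "P F" and max: "\<And>G. P G \<Longrightarrow> card G \<le> card F"
    by blast
  show thesis
  proof
    show "finite F" "real (card F) \<le> (1 + 2 / e) ^ dim V"
      using F bound by (auto simp: P_def)
    fix x assume x: "x \<in> V" "norm x \<le> 1"
    show "\<exists>y\<in>F. dist x y \<le> e"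
    proof (rule ccontr)
      assume "\<not> ?thesis"
      then have far: "\<forall>y\<in>F. e < dist x y"
        by auto
      then have "x \<notin> F"
        using e by force
      have "P (insert x F)"
        using F x far by (auto simp: P_def dist_commute)
      with max have "card (insert x F) \<le> card F"
        by blast
      with \<open>x \<notin> F\<close> \<open>finite F\<close> show False
        by simp
    qed
  qed
qed

subsection \<open>Hamming balls\<close>

text \<open>
  Weight each subset \<open>A\<close> of \<open>S\<close> by \<open>p\<^bsup>|A|\<^esup>(1-p)\<^bsup>n-|A|\<^esup>\<close>: the weights sum to \<open>1\<close>, and as \<open>p \<le> 1 - p\<close>, those
  of the subsets counted here are at least \<open>p\<^bsup>pn\<^esup>(1-p)\<^bsup>(1-p)n\<^esup>\<close>.
\<close>

lemma card_small_subsets_le: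
  fixes p :: real
  assumes fin: "finite S" and p: "0 < p" "p \<le> 1/2"
  shows "real (card {A \<in> Pow S. real (card A) \<le> p * card S}) \<le> 2 powr (H2 p * card S)"
proof -
  let ?n = "real (card S)"
  let ?B = "{A \<in> Pow S. real (card A) \<le> p * card S}"
  let ?w = "\<lambda>A. p ^ card A * (1 - p) ^ card (S - A)"
  have "2 powr (- H2 p * ?n) \<le> ?w A" if "A \<in> ?B" for A
  proof -
    have A: "A \<subseteq> S" "card A \<le> p * ?n"
      using that by auto
    have c: "real (card (S - A)) = ?n - card A"
      using A fin by (simp add: card_Diff_subset card_mono finite_subset of_nat_diff)
    have "log 2 p \<le> log 2 (1 - p)"
      using p by simp
    then have "(log 2 (1 - p) - log 2 p) * card A \<le> (log 2 (1 - p) - log 2 p) * (p * ?n)"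
      using A by (intro mult_left_mono) auto
    then have "- H2 p * ?n \<le> log 2 p * card A + log 2 (1 - p) * card (S - A)"
      unfolding H2_def c by (simp add: algebra_simps)
    then have "2 powr (- H2 p * ?n) \<le> 2 powr (log 2 p * card A + log 2 (1 - p) * card (S - A))"
      by simp
    also have "\<dots> = (2 powr log 2 p) powr card A * (2 powr log 2 (1 - p)) powr card (S - A)"
      by (simp add: powr_add powr_powr)
    also have "\<dots> = ?w A"
      using p by (simp add: powr_realpow)
    finally show ?thesis .
  qed
  then have "card ?B * 2 powr (- H2 p * ?n) \<le> (\<Sum>A\<in>?B. ?w A)"
    by (rule sum_bounded_below)
  also have "\<dots> \<le> (\<Sum>A\<in>Pow S. ?w A)"
    using fin p by (intro sum_mono2) auto
  \<comment> \<open>Expanding this product chooses \<open>p\<close> on a subset \<open>A\<close> and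
    \<open>1 - p\<close> off it, which yields exactly the weights.\<close>
  also have "\<dots> = (\<Prod>x\<in>S. p + (1 - p))"
    unfolding prod_add[OF fin] by simp
  finally show ?thesis
    by (simp add: powr_minus field_simps)
qed

section \<open>Distances in the cube and cube points in a ball\<close>

text \<open>Two coordinates agree or are opposite; an opposite pair differs by
  \<open>2 / sqrt n\<close> and contributes \<open>4 / n\<close>. This turns Euclidean distance into
  Hamming distance.\<close>

lemma sign_cube_dist:
  fixes x y :: "real ^ 'n"
  assumes "x \<in> sign_cube" "y \<in> sign_cube"
  shows "(dist x y)\<^sup>2 = 4 * real (card {i. x $ i \<noteq> y $ i}) / real CARD('n)"
proof -
  let ?s = "1 / sqrt (real CARD('n))"
  have s: "?s\<^sup>2 = 1 / real CARD('n)"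
    by (simp add: power_divide)
  have coord: "(x $ i - y $ i)\<^sup>2 = (if x $ i \<noteq> y $ i then 4 / real CARD('n) else 0)" for i
  proof -
    have "x $ i \<in> {?s, - ?s}" "y $ i \<in> {?s, - ?s}"
      using assms by (simp_all add: sign_cube_def)
    then have "x $ i = y $ i \<or> (x $ i - y $ i)\<^sup>2 = 4 * ?s\<^sup>2"
      by (auto simp: power2_eq_square)
    then show ?thesis
      unfolding s by auto
  qed
  have "(dist x y)\<^sup>2 = (\<Sum>i\<in>UNIV. (x $ i - y $ i)\<^sup>2)"
    by (simp add: dist_norm norm_vec_def L2_set_def sum_nonneg)
  also have "\<dots> = (\<Sum>i\<in>{i. x $ i \<noteq> y $ i}. 4 / real CARD('n))"
    unfolding coord by (simp add: sum.If_cases)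
  finally show ?thesis
    by simp
qed

lemma norm_sign_cube:
  fixes x :: "real ^ 'n"
  assumes "x \<in> sign_cube"
  shows "norm x = 1"
proof -
  have "\<bar>x $ i\<bar> = 1 / sqrt (real CARD('n))" for i
    using assms by (auto simp: sign_cube_def dest!: spec[of _ i])
  then have "norm x = sqrt (\<Sum>i\<in>(UNIV :: 'n set). (1 / sqrt (real CARD('n)))\<^sup>2)"
    by (simp add: norm_vec_def L2_set_def)
  then show ?thesis
    by (simp add: power_divide)
qed

lemma finite_sign_cube: "finite (sign_cube :: (real ^ 'n) set)"
proof -
  let ?s = "1 / sqrt (real CARD('n))"
  have "sign_cube \<subseteq> (\<lambda>f. \<chi> i. f i) ` (UNIV \<rightarrow>\<^sub>E {?s, - ?s} :: ('n \<Rightarrow> real) set)"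
  proof
    fix x :: "real ^ 'n" assume "x \<in> sign_cube"
    then have "(\<lambda>i. x $ i) \<in> UNIV \<rightarrow>\<^sub>E {?s, - ?s}"
      by (auto simp: sign_cube_def)
    then show "x \<in> (\<lambda>f. \<chi> i. f i) ` (UNIV \<rightarrow>\<^sub>E {?s, - ?s})"
      by (rule rev_image_eqI) simp
  qed
  then show ?thesis
    by (rule finite_subset) (intro finite_imageI finite_PiE, auto)
qed

text \<open>The centre \<open>q\<close> is arbitrary, so the count is taken around a cube point
  \<open>x0\<close> in the ball, at the cost of doubling the radius. A cube point is encoded by the
  set of its \<open>k\<close> differences from \<open>x0\<close>, and
  \<open>4 * k / n \<le> (2 * d)\<^sup>2\<close> gives \<open>k \<le> d\<^sup>2 * n\<close>.\<close>

lemma card_sign_cube_cball_le: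
  fixes q :: "real ^ 'n"
  assumes d: "0 < d" "2 * d\<^sup>2 \<le> 1"
  shows "real (card (sign_cube \<inter> cball q d)) \<le> 2 powr (H2 (d\<^sup>2) * real CARD('n))"
proof (cases "sign_cube \<inter> cball q d = {}")
  case False
  then obtain x0 where x0: "x0 \<in> sign_cube" "x0 \<in> cball q d"
    by auto
  let ?n = "real CARD('n)"
  let ?D = "\<lambda>x. {i. x $ i \<noteq> x0 $ i}"
  let ?B = "{A \<in> Pow (UNIV :: 'n set). real (card A) \<le> d\<^sup>2 * ?n}"
  have "card (sign_cube \<inter> cball q d) \<le> card ?B"
  proof (rule card_inj_on_le)
    show "inj_on ?D (sign_cube \<inter> cball q d)"
    proof (rule inj_onI)
      fix x y assume xy: "x \<in> sign_cube \<inter> cball q d" "y \<in> sign_cube \<inter> cball q d"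
        and eq: "?D x = ?D y"
      have "x $ i = y $ i" for i
      proof -
        \<comment> \<open>Only two values are possible, so two coordinates that both differ from
          that of \<open>x0\<close> are equal.\<close>
        have "x $ i \<noteq> x0 $ i \<longleftrightarrow> y $ i \<noteq> x0 $ i"
          using eq by blast
        moreover have "v $ i \<in> {1 / sqrt ?n, - (1 / sqrt ?n)}" if "v \<in> sign_cube" for v :: "real ^ 'n"
          using that by (simp add: sign_cube_def)
        ultimately show ?thesis
          using xy x0 by (metis IntD1 insertE singletonD)
      qed
      then show "x = y"
        by (simp add: vec_eq_iff)
    qed
    show "?D ` (sign_cube \<inter> cball q d) \<subseteq> ?B"
    proof safe
      fix x assume x: "x \<in> sign_cube" "x \<in> cball q d"
      have "dist x x0 \<le> 2 * d"
        using x x0 dist_triangle2[of x x0 q] by (simp add: dist_commute)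
      then have "(dist x x0)\<^sup>2 \<le> (2 * d)\<^sup>2"
        by (rule power_mono) simp
      then show "real (card (?D x)) \<le> d\<^sup>2 * ?n"
        unfolding sign_cube_dist[OF x(1) x0(1)] by (simp add: field_simps power2_eq_square)
    qed simp
  qed simp
  also have "real (card ?B) \<le> 2 powr (H2 (d\<^sup>2) * ?n)"
    using d by (intro card_small_subsets_le) auto
  finally show ?thesis
    by simp
qed simp

section \<open>Projection to the subspace and the final count\<close>

text \<open>The point is the orthogonal projection of \<open>x\<close>. Pythagoras for
  \<open>x = y + z\<close> bounds its norm, and for \<open>x - v = (y - v) + z\<close> shows that no
  \<open>v\<close> in \<open>V\<close> is closer.\<close>

lemma subspace_nearby_point:
  fixes V :: "'a::euclidean_space set"
  assumes V: "subspace V"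
  obtains y where "y \<in> V" "norm y \<le> norm x" "dist x y \<le> infdist x V"
proof -
  obtain y z where "y \<in> span V" and orth: "\<And>w. w \<in> span V \<Longrightarrow> orthogonal z w" and x: "x = y + z"
    by (rule orthogonal_subspace_decomp_exists[of V x]) (rule that)
  then have y: "y \<in> V"
    using V by (metis span_eq_iff)
  have pyth: "(norm (w + z))\<^sup>2 = (norm w)\<^sup>2 + (norm z)\<^sup>2" if "w \<in> V" for w
    using orth[of w] that by (intro norm_add_Pythagorean) (simp add: orthogonal_commute span_base)
  have "norm y \<le> norm x"
    by (rule power2_le_imp_le) (simp_all add: pyth[OF y] x)
  \<comment> \<open>\<open>infdist\<close> to the empty set is \<open>0\<close> by convention; for
    nonempty \<open>V\<close> it is an infimum, so \<open>dist x y\<close> only has to be a lower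
    bound.\<close>
  moreover have "V \<noteq> {}"
    using y by auto
  then have "dist x y \<le> infdist x V"
    unfolding infdist_notempty[OF \<open>V \<noteq> {}\<close>]
  proof (rule cINF_greatest)
    fix v assume "v \<in> V"
    then have "(norm (y - v + z))\<^sup>2 = (norm (y - v))\<^sup>2 + (norm z)\<^sup>2"
      using V y by (intro pyth subspace_diff)
    then have "(norm z)\<^sup>2 \<le> (norm (y - v + z))\<^sup>2"
      by simp
    then have "norm z \<le> norm (y - v + z)"
      by (rule power2_le_imp_le) simp
    then show "dist x y \<le> dist x v"
      by (simp add: x dist_norm algebra_simps)
  qed
  ultimately show thesis
    using that y by blast
qed

theorem theorem7p1:
  fixes V :: "(real ^ 'n) set" and \<alpha> \<epsilon> :: real
  assumes "subspace V"
    and "0 < \<alpha>" and "\<alpha> < 1"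
    and "real (dim V) = \<alpha> * real CARD('n)"
    and "0 < \<epsilon>" and "\<epsilon> < 1 / 4"
  shows "real (card {x \<in> sign_cube. infdist x V \<le> \<epsilon>})
    \<le> 2 powr ((H2 (4 * \<epsilon>\<^sup>2) + \<alpha> * log 2 (3 / \<epsilon>)) * real CARD('n))"
proof -
  let ?n = "real CARD('n)"
  let ?X = "{x \<in> sign_cube. infdist x V \<le> \<epsilon>}"
  let ?N = "2 powr (H2 (4 * \<epsilon>\<^sup>2) * ?n)"
  \<comment> \<open>For radius \<open>d = 2 * \<epsilon>\<close> this gives
    \<open>2 * d\<^sup>2 \<le> 1/2\<close>, within the range of the ball count.\<close>
  have "\<epsilon>\<^sup>2 \<le> (1/4)\<^sup>2"
    using assms by (intro power_mono) auto
  then have ball: "real (card (sign_cube \<inter> cball q (2 * \<epsilon>))) \<le> ?N" for q :: "real ^ 'n"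
    using card_sign_cube_cball_le[of "2 * \<epsilon>" q] assms by (simp add: power2_eq_square)
  obtain F where F: "finite F" "real (card F) \<le> (1 + 2 / \<epsilon>) ^ dim V"
    and net: "\<And>x. x \<in> V \<Longrightarrow> norm x \<le> 1 \<Longrightarrow> \<exists>y\<in>F. dist x y \<le> \<epsilon>"
    using ball_net_subspace[OF assms(1,5)] by metis
  have "?X \<subseteq> (\<Union>q\<in>F. sign_cube \<inter> cball q (2 * \<epsilon>))"
  proof safe
    fix x assume x: "x \<in> sign_cube" "infdist x V \<le> \<epsilon>"
    obtain y where y: "y \<in> V" "norm y \<le> norm x" "dist x y \<le> infdist x V"
      using subspace_nearby_point[OF assms(1)] by metis
    then obtain q where "q \<in> F" "dist y q \<le> \<epsilon>"
      using net norm_sign_cube[OF x(1)] by auto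
    then show "x \<in> (\<Union>q\<in>F. sign_cube \<inter> cball q (2 * \<epsilon>))"
      using x y dist_triangle[of x q y] by (auto simp: dist_commute intro!: bexI[of _ q])
  qed
  then have "card ?X \<le> card (\<Union>q\<in>F. sign_cube \<inter> cball q (2 * \<epsilon>))"
    using F(1) by (intro card_mono) (auto simp: finite_sign_cube)
  also have "\<dots> \<le> (\<Sum>q\<in>F. card (sign_cube \<inter> cball q (2 * \<epsilon>)))"
    by (rule card_UN_le[OF F(1)])
  finally have "real (card ?X) \<le> (\<Sum>q\<in>F. real (card (sign_cube \<inter> cball q (2 * \<epsilon>))))"
    by (simp flip: of_nat_sum)
  also have "\<dots> \<le> card F * ?N"
    using ball by (intro sum_bounded_above) auto
  also have "\<dots> \<le> (3 / \<epsilon>) ^ dim V * ?N"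
  proof (intro mult_right_mono order_trans[OF F(2)] power_mono)
    \<comment> \<open>Holds because \<open>\<epsilon> < 1\<close> gives
      \<open>1 \<le> 1 / \<epsilon>\<close>; this is the source of the constant
      \<open>3\<close>.\<close>
    show "1 + 2 / \<epsilon> \<le> 3 / \<epsilon>"
      using assms by (simp add: field_simps)
  qed (use assms in auto)
  also have "(3 / \<epsilon>) ^ dim V = (3 / \<epsilon>) powr (\<alpha> * ?n)"
    using assms by (simp flip: assms(4) add: powr_realpow)
  also have "\<dots> = 2 powr (\<alpha> * log 2 (3 / \<epsilon>) * ?n)"
    using assms powr_powr[of 2 "log 2 (3 / \<epsilon>)" "\<alpha> * ?n"] by (simp add: mult_ac)
  also have "\<dots> * ?N = 2 powr ((H2 (4 * \<epsilon>\<^sup>2) + \<alpha> * log 2 (3 / \<epsilon>)) * ?n)"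
    by (simp add: powr_add distrib_right)
  finally show ?thesis .
qed

end
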